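(* Let $S$ be a weak Gaussian semiring, $M$ a nonzero $S$-semimodule, and $G$ a cancellative torsion-free commutative monoid. Then the $S[G]$-semimodule $M[G]$ is primal if and only if the $S$-semimodule $M$ is primal and has Property (A).
   Context: A semiring is a set $S$ with operations $+,\cdot$ such that $(S,+)$ is a commutative monoid with identity $0$, $(S,\cdot)$ is a commutative monoid with identity $1\neq 0$, multiplication distributes over addition, and $s\cdot 0=0$ for all $s\in S$. An $S$-semimodule is a commutative monoid $(M,+,0)$ with a scalar multiplication $S\times M\to M$ satisfying the usual module axioms together with $0_S\cdot m=0_M=s\cdot 0_M$ and $1\cdot m=m$. A commutative monoid $G$ (written additively) is cancellative if $a+b=a+c$ implies $b=c$, and torsion-free if $na=nb$ with $n\geq 1$ implies $a=b$. $S[G]$ is the monoid semiring (finite formal sums $\sum s_iX^{g_i}$ with $X^gX^h=X^{g+h}$), and $M[G]$ is the set of finite formal sums $\sum m_iX^{g_i}$, $m_i\in M$, an $S[G]$-semimodule via $(sX^g)(mX^h)=(sm)X^{g+h}$. An ideal of $S$ is a nonempty subset closed under addition and under multiplication by elements of $S$; a proper ideal $\mathbf p$ is prime if $ab\in\mathbf p$ implies $a\in\mathbf p$ or $b\in\mathbf p$. $\sqrt I=\{s\in S: s^n\in I \text{ for some } n\geq 1\}$. For $f\in S[X]$, $c(f)$ is the ideal generated by the coefficients of $f$. $S$ is weak Gaussian if $c(f)c(g)\subseteq\sqrt{c(fg)}$ for all $f,g\in S[X]$; equivalently (known), every prime ideal $\mathbf p$ of $S$ is subtractive, i.e. $a+b,a\in\mathbf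 p$ imply $b\in\mathbf p$. For a nonzero $S$-semimodule $M$, $Z_S(M)$ is the set of $s\in S$ such that $sm=0$ for some nonzero $m\in M$. $M$ is primal if $Z_S(M)$ is an ideal of $S$. $M$ has Property (A) if every finitely generated ideal $I\subseteq Z_S(M)$ has a nonzero annihilator in $M$, i.e. $I\cdot m=0$ for some nonzero $m\in M$.
   Formalization: The monoid G is additionally assumed nontrivial (G ≠ {0}); for G = {0} the claim would say that every primal M has Property (A), which fails e.g. for S = k[x,y] localized at (x,y) and M the direct sum of S/p over all height-one primes p. *)

theory Defs
  imports
    "HOL-Library.Poly_Mapping"
    "HOL-Computational_Algebra.Polynomial"
begin

text \<open>
  Semirings are types of class \<open>comm_semiring_1\<close> (this class includes \<open>0 \<noteq> 1\<close>). The monoid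
  semiring \<open>S[G]\<close> is the type \<open>'g \<Rightarrow>\<^sub>0 's\<close> with its convolution product, and the commutative
  monoid \<open>M[G]\<close> is the type \<open>'g \<Rightarrow>\<^sub>0 'm\<close>.
\<close>

locale semimodule =
  fixes scale :: "'s::comm_semiring_1 \<Rightarrow> 'm::comm_monoid_add \<Rightarrow> 'm"
  assumes scale_add_right: "scale s (m + n) = scale s m + scale s n"
    and scale_add_left: "scale (s + t) m = scale s m + scale t m"
    and scale_mult: "scale (s * t) m = scale s (scale t m)"
    and scale_one: "scale 1 m = m"
    and scale_zero_left: "scale 0 m = 0"
    and scale_zero_right: "scale s 0 = 0"

definition monoid_scale ::
  "('s::comm_semiring_1 \<Rightarrow> 'm::comm_monoid_add \<Rightarrow> 'm) \<Rightarrow>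
    ('g::comm_monoid_add \<Rightarrow>\<^sub>0 's) \<Rightarrow> ('g \<Rightarrow>\<^sub>0 'm) \<Rightarrow> ('g \<Rightarrow>\<^sub>0 'm)"
  where "monoid_scale scale f h =
    (\<Sum>a\<in>Poly_Mapping.keys f. \<Sum>b\<in>Poly_Mapping.keys h.
       Poly_Mapping.single (a + b) (scale (Poly_Mapping.lookup f a) (Poly_Mapping.lookup h b)))"

definition semiring_ideal :: "'s::comm_semiring_1 set \<Rightarrow> bool"
  where "semiring_ideal I \<longleftrightarrow>
    I \<noteq> {} \<and> (\<forall>a\<in>I. \<forall>b\<in>I. a + b \<in> I) \<and> (\<forall>s. \<forall>a\<in>I. s * a \<in> I)"

definition ideal_generated :: "'s::comm_semiring_1 set \<Rightarrow> 's set"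
  where "ideal_generated A = semiring_ideal hull A"

definition finitely_generated_ideal :: "'s::comm_semiring_1 set \<Rightarrow> bool"
  where "finitely_generated_ideal I \<longleftrightarrow> (\<exists>A. finite A \<and> I = ideal_generated A)"

definition ideal_product :: "'s::comm_semiring_1 set \<Rightarrow> 's set \<Rightarrow> 's set"
  where "ideal_product I J = ideal_generated {a * b | a b. a \<in> I \<and> b \<in> J}"

definition ideal_radical :: "'s::comm_semiring_1 set \<Rightarrow> 's set"
  where "ideal_radical I = {s. \<exists>n\<ge>1. s ^ n \<in> I}"

definition content_ideal :: "'s::comm_semiring_1 poly \<Rightarrow> 's set"
  where "content_ideal f = ideal_generated (range (coeff f))"

definition weak_gaussian :: "'s::comm_semiring_1 itself \<Rightarrow> bool"
  where "weak_gaussian _ \<longleftrightarrow>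
    (\<forall>f g :: 's poly.
       ideal_product (content_ideal f) (content_ideal g) \<subseteq> ideal_radical (content_ideal (f * g)))"

definition zero_divisors :: "('s::comm_semiring_1 \<Rightarrow> 'm::comm_monoid_add \<Rightarrow> 'm) \<Rightarrow> 's set"
  where "zero_divisors scale = {s. \<exists>m. m \<noteq> 0 \<and> scale s m = 0}"

definition primal :: "('s::comm_semiring_1 \<Rightarrow> 'm::comm_monoid_add \<Rightarrow> 'm) \<Rightarrow> bool"
  where "primal scale \<longleftrightarrow> semiring_ideal (zero_divisors scale)"

definition property_A :: "('s::comm_semiring_1 \<Rightarrow> 'm::comm_monoid_add \<Rightarrow> 'm) \<Rightarrow> bool"
  where "property_A scale \<longleftrightarrow>
    (\<forall>I. finitely_generated_ideal I \<and> I \<subseteq> zero_divisors scale \<longrightarrow>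
       (\<exists>m. m \<noteq> 0 \<and> (\<forall>s\<in>I. scale s m = 0)))"

text \<open>The sum \<open>\<Sum>i<n. a\<close> is the multiple \<open>n a\<close>.\<close>

definition torsion_free_monoid :: "'g::comm_monoid_add itself \<Rightarrow> bool"
  where "torsion_free_monoid _ \<longleftrightarrow>
    (\<forall>(a::'g) b. \<forall>n::nat. n \<ge> 1 \<longrightarrow> (\<Sum>i<n. a) = (\<Sum>i<n. b) \<longrightarrow> a = b)"

text \<open>Generated ideals are ideals, and \<open>M[G]\<close> is an \<open>S[G]\<close>-semimodule with
  \<open>(s X\<^sup>g) (m X\<^sup>h) = (s m) X\<^sup>g\<^sup>+\<^sup>h\<close>.\<close>

lemma zero_in_semiring_ideal: "semiring_ideal I \<Longrightarrow> 0 \<in> I"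
  unfolding semiring_ideal_def by (metis ex_in_conv mult_zero_left)

lemma semiring_ideal_ideal_generated: "semiring_ideal (ideal_generated A)"
proof -
  have "semiring_ideal (\<Inter>{t. semiring_ideal t \<and> A \<subseteq> t})"
    unfolding semiring_ideal_def[of "\<Inter> _"]
  proof (intro conjI)
    show "\<Inter>{t. semiring_ideal t \<and> A \<subseteq> t} \<noteq> {}"
      using zero_in_semiring_ideal by blast
  qed (auto simp: semiring_ideal_def)
  then show ?thesis by (simp add: ideal_generated_def hull_def)
qed

lemma poly_mapping_single_induct [case_names single sum]:
  fixes f :: "'a \<Rightarrow>\<^sub>0 'b::comm_monoid_add"
  assumes single: "\<And>k v. P (Poly_Mapping.single k v)"
    and sum: "\<And>p q. P p \<Longrightarrow> P q \<Longrightarrow> P (p + q)"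
  shows "P f"
proof -
  have eq: "f = (\<Sum>k\<in>Poly_Mapping.keys f. Poly_Mapping.single k (Poly_Mapping.lookup f k))"
    by (rule poly_mapping_eqI) (auto simp: lookup_sum lookup_single when_def in_keys_iff)
  have "P (\<Sum>k\<in>A. Poly_Mapping.single k (Poly_Mapping.lookup f k))" if "finite A" for A
    using that
  proof (induction A rule: finite_induct)
    case empty
    show ?case using single[of undefined 0] by simp
  next
    case (insert x F)
    then show ?case by (simp add: single sum)
  qed
  with eq show ?thesis by (metis finite_keys)
qed

context semimodule
begin

lemma monoid_scale_superset:
  assumes "finite A" "finite B" "Poly_Mapping.keys f \<subseteq> A" "Poly_Mapping.keys h \<subseteq> B"
  shows "monoid_scale scale f h = (\<Sum>a\<in>A. \<Sum>b\<in>B.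
    Poly_Mapping.single (a + b) (scale (Poly_Mapping.lookup f a) (Poly_Mapping.lookup h b)))"
proof -
  have inner: "(\<Sum>b\<in>Poly_Mapping.keys h.
      Poly_Mapping.single (a + b) (scale (Poly_Mapping.lookup f a) (Poly_Mapping.lookup h b))) =
    (\<Sum>b\<in>B. Poly_Mapping.single (a + b) (scale (Poly_Mapping.lookup f a) (Poly_Mapping.lookup h b)))"
    for a
    using assms by (intro sum.mono_neutral_left) (auto simp: in_keys_iff scale_zero_right)
  show ?thesis
    unfolding monoid_scale_def inner
    using assms by (intro sum.mono_neutral_left) (auto simp: in_keys_iff scale_zero_left)
qed

lemma monoid_scale_single:
  "monoid_scale scale (Poly_Mapping.single g s) (Poly_Mapping.single h m) =
    Poly_Mapping.single (g + h) (scale s m)"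
  by (subst monoid_scale_superset[of "{g}" "{h}"]) auto

lemma monoid_scale_add_right:
  "monoid_scale scale f (h + k) = monoid_scale scale f h + monoid_scale scale f k"
proof -
  let ?A = "Poly_Mapping.keys f" and ?B = "Poly_Mapping.keys h \<union> Poly_Mapping.keys k"
  note * = monoid_scale_superset[of ?A ?B f]
  show ?thesis
    using Poly_Mapping.keys_add[of h k]
    by (simp add: * lookup_add scale_add_right single_add sum.distrib)
qed

lemma monoid_scale_add_left:
  "monoid_scale scale (f + k) h = monoid_scale scale f h + monoid_scale scale k h"
proof -
  let ?B = "Poly_Mapping.keys h" and ?A = "Poly_Mapping.keys f \<union> Poly_Mapping.keys k"
  note * = monoid_scale_superset[of ?A ?B _ h]
  show ?thesis
    using Poly_Mapping.keys_add[of f k]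
    by (simp add: * lookup_add scale_add_left single_add sum.distrib)
qed

lemma monoid_scale_zero_left: "monoid_scale scale 0 h = 0"
  and monoid_scale_zero_right: "monoid_scale scale f 0 = 0"
  by (simp_all add: monoid_scale_def)

lemma monoid_scale_one: "monoid_scale scale 1 h = h"
proof (induction h rule: poly_mapping_single_induct)
  case (single k v)
  then show ?case by (simp only: single_one[symmetric] monoid_scale_single scale_one add_0_left)
next
  case (sum p q)
  then show ?case by (simp add: monoid_scale_add_right)
qed

lemma monoid_scale_mult:
  "monoid_scale scale (f * k) h = monoid_scale scale f (monoid_scale scale k h)"
proof (induction f rule: poly_mapping_single_induct)
  case f: (single a s)
  show ?case
  proof (induction k rule: poly_mapping_single_induct)
    case k: (single b t)
    show ?case
    proof (induction h rule: poly_mapping_single_induct)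
      case (single c m)
      show ?case by (simp add: mult_single monoid_scale_single scale_mult add.assoc)
    qed (simp add: monoid_scale_add_right)
  qed (simp add: monoid_scale_add_right monoid_scale_add_left distrib_left)
qed (simp add: monoid_scale_add_left distrib_right)

lemma semimodule_monoid_scale:
  "semimodule (monoid_scale scale :: ('g::comm_monoid_add \<Rightarrow>\<^sub>0 's) \<Rightarrow> ('g \<Rightarrow>\<^sub>0 'm) \<Rightarrow> ('g \<Rightarrow>\<^sub>0 'm))"
  by unfold_locales
    (simp_all add: monoid_scale_add_right monoid_scale_add_left monoid_scale_mult
      monoid_scale_one monoid_scale_zero_left monoid_scale_zero_right)

end

end

theory Submission
  imports Defs
begin

text \<open>
  A cancellative torsion-free commutative monoid is orderable, so two nonempty finite subsets
  \<open>A\<close>, \<open>B\<close> always have a sum \<open>a + b\<close> that arises only once. McCoy's argument then works without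
  subtraction: if \<open>f h = 0\<close> with \<open>h \<noteq> 0\<close> of minimal support, consider the coefficients of \<open>f\<close> that
  do not annihilate \<open>h\<close>. If there are any, a uniquely arising sum gives one of them, \<open>s\<close>, that
  annihilates a coefficient of \<open>h\<close>, and \<open>s h\<close> contradicts minimality. So the zero divisors
  of \<open>M[G]\<close> are the \<open>f\<close> whose coefficients have a common nonzero annihilator in \<open>M\<close>. One
  direction is then immediate; for the other, a finite set of zero divisors of \<open>M\<close> is turned into
  an element of \<open>S[G]\<close> by placing its members at distinct multiples of some \<open>g \<noteq> 0\<close>.
\<close>

section \<open>Multiples in a commutative monoid\<close>

definition nat_multiple :: "nat \<Rightarrow> 'g::comm_monoid_add \<Rightarrow> 'g"
  where "nat_multiple n a = (\<Sum>i<n. a)"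

lemma nat_multiple_0 [simp]: "nat_multiple 0 a = 0"
  and nat_multiple_Suc: "nat_multiple (Suc n) a = nat_multiple n a + a"
  by (simp_all add: nat_multiple_def)

lemma nat_multiple_1 [simp]: "nat_multiple (Suc 0) a = a"
  by (simp add: nat_multiple_Suc)

lemma nat_multiple_zero_right [simp]: "nat_multiple n 0 = 0"
  by (simp add: nat_multiple_def)

lemma nat_multiple_add_right: "nat_multiple n (a + b) = nat_multiple n a + nat_multiple n b"
  by (simp add: nat_multiple_def sum.distrib)

lemma nat_multiple_add_left: "nat_multiple (m + n) a = nat_multiple m a + nat_multiple n a"
  by (induction n) (simp_all add: nat_multiple_Suc add.assoc)

lemma nat_multiple_mult: "nat_multiple (m * n) a = nat_multiple m (nat_multiple n a)"
  by (induction m) (simp_all add: nat_multiple_Suc nat_multiple_add_left add.commute)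

lemma torsion_free_monoidD:
  assumes "torsion_free_monoid TYPE('g::comm_monoid_add)" "n \<ge> 1"
    and "nat_multiple n (a::'g) = nat_multiple n b"
  shows "a = b"
  using assms unfolding torsion_free_monoid_def nat_multiple_def by blast

section \<open>Root-closed partial orders and their extension by one comparison\<close>

text \<open>The order is only partial; comparability is forced later, one pair at a time. Root
  closure lets positive multiples be cancelled, which keeps each extension antisymmetric.\<close>

locale root_closed_order =
  fixes le :: "'g::comm_monoid_add \<Rightarrow> 'g \<Rightarrow> bool"
  assumes refl: "le x x"
    and trans: "le x y \<Longrightarrow> le y z \<Longrightarrow> le x z"
    and antisym: "le x y \<Longrightarrow> le y x \<Longrightarrow> x = y"
    and add_right_iff: "le (x + z) (y + z) \<longleftrightarrow> le x y"
    and root_closed: "n \<ge> 1 \<Longrightarrow> le (nat_multiple n x) (nat_multiple n y) \<Longrightarrow> le x y"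
begin

lemma add_left_iff: "le (z + x) (z + y) \<longleftrightarrow> le x y"
  using add_right_iff[of x z y] by (simp add: add.commute)

lemma add_mono: "le a b \<Longrightarrow> le c d \<Longrightarrow> le (a + c) (b + d)"
  by (rule trans[of _ "b + c"]) (simp_all add: add_right_iff add_left_iff)

lemma nat_multiple_mono: "le x y \<Longrightarrow> le (nat_multiple n x) (nat_multiple n y)"
  by (induction n) (simp_all add: refl nat_multiple_Suc add_mono)

text \<open>In the group of differences this is \<open>k (v - u) \<ge> n (y - x)\<close>: the least root-closed
  extension in which \<open>x\<close> is below \<open>y\<close>.\<close>

definition ext :: "'g \<Rightarrow> 'g \<Rightarrow> 'g \<Rightarrow> 'g \<Rightarrow> bool"
  where "ext x y u v \<longleftrightarrow> (\<exists>k\<ge>1. \<exists>n.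
    le (nat_multiple k u + nat_multiple n y) (nat_multiple k v + nat_multiple n x))"

lemma ext_if_le: "le u v \<Longrightarrow> ext x y u v"
  unfolding ext_def by (rule exI[of _ 1], simp, rule exI[of _ 0], simp)

lemma ext_new: "ext x y x y"
  unfolding ext_def
  by (rule exI[of _ 1], simp, rule exI[of _ 1]) (simp add: refl add.commute)

text \<open>Scaling the first inequality by \<open>l\<close> and the second by \<open>k\<close>
  makes both speak of \<open>l * k\<close> times \<open>v\<close>, so they chain. This yields
  transitivity of \<open>ext x y\<close> and, with \<open>w = u\<close>, its antisymmetry.\<close>

lemma ext_compose:
  assumes "le (nat_multiple k u + nat_multiple n y) (nat_multiple k v + nat_multiple n x)"
    and "le (nat_multiple l v + nat_multiple m y) (nat_multiple l w + nat_multiple m x)"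
  shows "le (nat_multiple (l * k) u + nat_multiple (l * n + k * m) y)
    (nat_multiple (l * k) w + nat_multiple (l * n + k * m) x)"
proof -
  have 1: "le (nat_multiple (l * k) u + nat_multiple (l * n) y)
      (nat_multiple (l * k) v + nat_multiple (l * n) x)"
    using nat_multiple_mono[OF assms(1), of l]
    by (simp add: nat_multiple_add_right nat_multiple_mult)
  have 2: "le (nat_multiple (l * k) v + nat_multiple (k * m) y)
      (nat_multiple (l * k) w + nat_multiple (k * m) x)"
    using nat_multiple_mono[OF assms(2), of k]
    by (simp add: nat_multiple_add_right nat_multiple_mult[symmetric] mult.commute)
  \<comment> \<open>With \<open>l * n\<close> copies of \<open>x\<close> added to 2, its left side
    is the right side of 1 with \<open>k * m\<close> copies of \<open>y\<close> added.\<close>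
  have "le (nat_multiple (l * k) v + nat_multiple (l * n) x + nat_multiple (k * m) y)
      (nat_multiple (l * k) w + nat_multiple (k * m) x + nat_multiple (l * n) x)"
    using add_right_iff[THEN iffD2, OF 2, of "nat_multiple (l * n) x"] by (simp only: ac_simps)
  from trans[OF add_right_iff[THEN iffD2, OF 1] this] show ?thesis
    by (simp only: nat_multiple_add_left ac_simps)
qed

lemma root_closed_order_ext:
  assumes "\<not> le y x"
  shows "root_closed_order (ext x y)"
proof
  fix u v w z :: 'g and j :: nat
  show "ext x y u u"
    by (simp add: ext_if_le refl)
  show "ext x y u w" if "ext x y u v" "ext x y v w"
  proof -
    obtain k n where "k \<ge> 1"
      and kn: "le (nat_multiple k u + nat_multiple n y) (nat_multiple k v + nat_multiple n x)"
      using \<open>ext x y u v\<close> unfolding ext_def by blast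
    obtain l m where "l \<ge> 1"
      and lm: "le (nat_multiple l v + nat_multiple m y) (nat_multiple l w + nat_multiple m x)"
      using \<open>ext x y v w\<close> unfolding ext_def by blast
    from \<open>k \<ge> 1\<close> \<open>l \<ge> 1\<close> have "l * k \<ge> 1" by simp
    with ext_compose[OF kn lm] show ?thesis unfolding ext_def by blast
  qed
  show "u = v" if "ext x y u v" "ext x y v u"
  proof -
    obtain k n where k: "k \<ge> 1"
      and kn: "le (nat_multiple k u + nat_multiple n y) (nat_multiple k v + nat_multiple n x)"
      using \<open>ext x y u v\<close> unfolding ext_def by blast
    obtain l m where l: "l \<ge> 1"
      and lm: "le (nat_multiple l v + nat_multiple m y) (nat_multiple l u + nat_multiple m x)"
      using \<open>ext x y v u\<close> unfolding ext_def by blast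
    \<comment> \<open>The cycle from \<open>u\<close> back to \<open>u\<close> cancels to a
      comparison of multiples of \<open>y\<close> and \<open>x\<close>. A positive multiplier would
      give \<open>le y x\<close>, so \<open>n\<close> and \<open>m\<close> vanish and
      \<open>le\<close> itself compares \<open>u\<close> and \<open>v\<close> both ways.\<close>
    have "le (nat_multiple (l * n + k * m) y) (nat_multiple (l * n + k * m) x)"
      using ext_compose[OF kn lm] by (simp add: add_left_iff)
    with assms root_closed have "\<not> l * n + k * m \<ge> 1" by blast
    then have "l * n + k * m = 0" by linarith
    with k l have "n = 0" "m = 0" by auto
    with kn lm have "le (nat_multiple k u) (nat_multiple k v)" "le (nat_multiple l v) (nat_multiple l u)"
      by simp_all
    with k l show ?thesis using antisym root_closed by blast
  qed
  \<comment> \<open>The multiple of \<open>z\<close> moves to the outside, where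
    \<open>add_right_iff\<close> cancels it.\<close>
  have swap: "nat_multiple k (u + z) + c = (nat_multiple k u + c) + nat_multiple k z"
    for k u c by (simp add: nat_multiple_add_right ac_simps)
  show "ext x y (u + z) (v + z) \<longleftrightarrow> ext x y u v"
    unfolding ext_def swap add_right_iff ..
  show "ext x y u v" if "j \<ge> 1" "ext x y (nat_multiple j u) (nat_multiple j v)"
  proof -
    obtain k n where "k \<ge> 1"
      "le (nat_multiple (k * j) u + nat_multiple n y) (nat_multiple (k * j) v + nat_multiple n x)"
      using \<open>ext x y (nat_multiple j u) (nat_multiple j v)\<close>
      unfolding ext_def nat_multiple_mult by blast
    moreover from \<open>k \<ge> 1\<close> \<open>j \<ge> 1\<close> have "k * j \<ge> 1" by simp
    ultimately show ?thesis unfolding ext_def by blast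
  qed
qed

lemma finite_has_greatest:
  assumes "finite A" "A \<noteq> {}" "\<And>x y. x \<in> A \<Longrightarrow> y \<in> A \<Longrightarrow> le x y \<or> le y x"
  shows "\<exists>a\<in>A. \<forall>x\<in>A. le x a"
  using assms
proof (induction A rule: finite_ne_induct)
  case (insert x F)
  then obtain a where "a \<in> F" "\<forall>z\<in>F. le z a" by auto
  with insert.prems[of x a] show ?case
    using refl trans by blast
qed (simp add: refl)

end

section \<open>Comparing finitely many pairs, and sums that arise once\<close>

text \<open>For equality, compatibility with addition is cancellation and root closure is
  torsion-freeness. This order starts the induction below.\<close>

lemma root_closed_order_eq:
  assumes cancel: "\<forall>a b c :: 'g::comm_monoid_add. a + b = a + c \<longrightarrow> b = c"
    and tf: "torsion_free_monoid TYPE('g)"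
  shows "root_closed_order ((=) :: 'g \<Rightarrow> 'g \<Rightarrow> bool)"
proof
  show "x + z = y + z \<longleftrightarrow> x = y" for x y z :: 'g
    by (metis cancel add.commute)
qed (use torsion_free_monoidD[OF tf] in auto)

text \<open>Only finitely many comparisons are required, so induction on \<open>P\<close> takes the
  place of Zorn's lemma: unless \<open>le y x\<close> holds already, the new pair is settled by
  \<open>ext x y\<close>, which contains \<open>le\<close> and so keeps all earlier
  comparisons.\<close>

lemma ex_root_closed_order_comparing:
  assumes "\<forall>a b c :: 'g::comm_monoid_add. a + b = a + c \<longrightarrow> b = c"
    and "torsion_free_monoid TYPE('g)"
    and "finite P"
  shows "\<exists>le. root_closed_order (le :: 'g \<Rightarrow> 'g \<Rightarrow> bool) \<and> (\<forall>(x, y)\<in>P. le x y \<or> le y x)"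
  using \<open>finite P\<close>
proof induction
  case empty
  show ?case using root_closed_order_eq[OF assms(1,2)] by auto
next
  case (insert p P)
  then obtain le :: "'g \<Rightarrow> 'g \<Rightarrow> bool" where le: "root_closed_order le"
    and P: "\<forall>(x, y)\<in>P. le x y \<or> le y x" by auto
  interpret root_closed_order le by (rule le)
  obtain x y where p: "p = (x, y)" by fastforce
  show ?case
  proof (cases "le y x")
    case True
    with le P p show ?thesis by blast
  next
    case False
    then have "root_closed_order (ext x y)" by (rule root_closed_order_ext)
    moreover have "\<forall>(u, v)\<in>insert p P. ext x y u v \<or> ext x y v u"
      using P p ext_new ext_if_le by blast
    ultimately show ?thesis by blast
  qed
qed

text \<open>For an order total on \<open>A \<union> B\<close>, the greatest elements of
  \<open>A\<close> and \<open>B\<close> have such a sum.\<close>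

lemma ex_unique_sum:
  assumes cancel: "\<forall>a b c :: 'g::comm_monoid_add. a + b = a + c \<longrightarrow> b = c"
    and tf: "torsion_free_monoid TYPE('g)"
    and fin: "finite A" "finite B" and ne: "A \<noteq> {}" "B \<noteq> ({} :: 'g set)"
  shows "\<exists>a\<in>A. \<exists>b\<in>B. \<forall>a'\<in>A. \<forall>b'\<in>B. a' + b' = a + b \<longrightarrow> a' = a \<and> b' = b"
proof -
  have "finite ((A \<union> B) \<times> (A \<union> B))" using fin by simp
  from ex_root_closed_order_comparing[OF cancel tf this]
  obtain le :: "'g \<Rightarrow> 'g \<Rightarrow> bool" where le: "root_closed_order le"
    and total: "\<forall>(x, y)\<in>(A \<union> B) \<times> (A \<union> B). le x y \<or> le y x" by auto
  interpret root_closed_order le by (rule le)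
  obtain a where a: "a \<in> A" "\<And>x. x \<in> A \<Longrightarrow> le x a"
    using finite_has_greatest[of A] fin ne total by auto
  obtain b where b: "b \<in> B" "\<And>x. x \<in> B \<Longrightarrow> le x b"
    using finite_has_greatest[of B] fin ne total by auto
  have "a' = a \<and> b' = b" if "a' \<in> A" "b' \<in> B" "a' + b' = a + b" for a' b'
  proof -
    \<comment> \<open>Here \<open>a + b = a' + b'\<close>, and replacing \<open>a'\<close> by the
      greatest \<open>a\<close> can only enlarge the sum. Cancelling \<open>a\<close> puts
      \<open>b\<close> below \<open>b'\<close>.\<close>
    have "le (a + b) (a + b')"
      using a(2)[OF \<open>a' \<in> A\<close>] that(3) add_right_iff[of a' b' a] by simp
    then have "b' = b"
      using b(2)[OF \<open>b' \<in> B\<close>] add_left_iff antisym by blast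
    with that(3) cancel show ?thesis by (metis add.commute)
  qed
  with a(1) b(1) show ?thesis by blast
qed

section \<open>Annihilators, zero divisors and McCoy's theorem\<close>

lemma single_eq_zero_iff: "Poly_Mapping.single k v = 0 \<longleftrightarrow> v = 0"
  by (metis lookup_single_eq lookup_zero single_zero)

lemma ideal_generated_subset:
  assumes "semiring_ideal I" "A \<subseteq> I"
  shows "ideal_generated A \<subseteq> I"
  unfolding ideal_generated_def using assms by (rule hull_minimal[rotated])

lemma subset_ideal_generated: "A \<subseteq> ideal_generated A"
  unfolding ideal_generated_def by (rule hull_subset)

context semimodule
begin

lemma semiring_ideal_annihilator: "semiring_ideal {s. scale s m = 0}"
proof -
  have "0 \<in> {s. scale s m = 0}" by (simp add: scale_zero_left)
  then show ?thesis
    unfolding semiring_ideal_def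
    by (intro conjI) (blast, simp_all add: scale_add_left scale_mult scale_zero_right)
qed

lemma zero_divisors_mult: "s \<in> zero_divisors scale \<Longrightarrow> t * s \<in> zero_divisors scale"
  unfolding zero_divisors_def mem_Collect_eq scale_mult by (metis scale_zero_right)

text \<open>Zero divisors always absorb multiplication, and 0 is one of them because the semimodule
  is nonzero; only closure under addition remains.\<close>

lemma primal_iff:
  assumes "\<exists>m::'m. m \<noteq> 0"
  shows "primal scale \<longleftrightarrow>
    (\<forall>s\<in>zero_divisors scale. \<forall>t\<in>zero_divisors scale. s + t \<in> zero_divisors scale)"
proof -
  have "0 \<in> zero_divisors scale"
    using assms scale_zero_left unfolding zero_divisors_def by blast
  then show ?thesis
    unfolding primal_def semiring_ideal_def by (auto intro: zero_divisors_mult)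
qed

lemma lookup_monoid_scale_single_0:
  "Poly_Mapping.lookup (monoid_scale scale (Poly_Mapping.single 0 s) h) b =
    scale s (Poly_Mapping.lookup h b)"
  by (subst monoid_scale_superset[of "{0}" "Poly_Mapping.keys h"])
    (auto simp: lookup_sum lookup_single when_def in_keys_iff scale_zero_right)

text \<open>Coefficients of \<open>f\<close> outside \<open>A\<close> annihilate \<open>h\<close>
  and contribute nothing, so the sum need only be unique among exponents from
  \<open>A\<close>.\<close>

lemma lookup_monoid_scale_unique_sum:
  assumes "finite A" "A \<subseteq> Poly_Mapping.keys f" "a \<in> A" "b \<in> Poly_Mapping.keys h"
    and ann: "\<And>a b. a \<notin> A \<Longrightarrow> scale (Poly_Mapping.lookup f a) (Poly_Mapping.lookup h b) = 0"
    and uniq: "\<And>a' b'. a' \<in> A \<Longrightarrow> b' \<in> Poly_Mapping.keys h \<Longrightarrow> a' + b' = a + b \<Longrightarrow>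
      a' = a \<and> b' = b"
  shows "Poly_Mapping.lookup (monoid_scale scale f h) (a + b) =
    scale (Poly_Mapping.lookup f a) (Poly_Mapping.lookup h b)"
proof -
  let ?c = "\<lambda>a b. scale (Poly_Mapping.lookup f a) (Poly_Mapping.lookup h b)"
  have "monoid_scale scale f h =
      (\<Sum>a\<in>A. \<Sum>b\<in>Poly_Mapping.keys h. Poly_Mapping.single (a + b) (?c a b))"
    unfolding monoid_scale_def
    by (rule sum.mono_neutral_right) (use assms in auto)
  then have "Poly_Mapping.lookup (monoid_scale scale f h) (a + b) =
      (\<Sum>a'\<in>A. \<Sum>b'\<in>Poly_Mapping.keys h. ?c a' b' when a' + b' = a + b)"
    by (simp add: lookup_sum lookup_single)
  \<comment> \<open>By uniqueness the condition on \<open>a' + b'\<close> splits into one on each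
    index, so the two sums collapse in turn.\<close>
  also have "\<dots> = (\<Sum>a'\<in>A. \<Sum>b'\<in>Poly_Mapping.keys h. if b' = b then (?c a' b' when a' = a) else 0)"
    by (intro sum.cong refl) (use uniq in \<open>auto simp: when_def\<close>)
  also have "\<dots> = (\<Sum>a'\<in>A. if a' = a then ?c a' b else 0)"
    using assms by (intro sum.cong refl) (simp add: when_def)
  also have "\<dots> = ?c a b"
    using assms by simp
  finally show ?thesis .
qed

lemma McCoy:
  fixes f :: "'g::comm_monoid_add \<Rightarrow>\<^sub>0 's" and h :: "'g \<Rightarrow>\<^sub>0 'm"
  assumes "\<forall>a b c :: 'g. a + b = a + c \<longrightarrow> b = c"
    and "torsion_free_monoid TYPE('g)"
    and "monoid_scale scale f h = 0" "h \<noteq> 0"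
  shows "\<exists>m. m \<noteq> 0 \<and> (\<forall>a. scale (Poly_Mapping.lookup f a) m = 0)"
  using assms(3,4)
proof (induction "card (Poly_Mapping.keys h)" arbitrary: h rule: less_induct)
  case less
  define N where "N = {a. \<exists>b. scale (Poly_Mapping.lookup f a) (Poly_Mapping.lookup h b) \<noteq> 0}"
  have sub: "N \<subseteq> Poly_Mapping.keys f"
    by (auto simp: N_def in_keys_iff scale_zero_left)
  then have fin: "finite N" by (rule finite_subset) simp
  have ne: "Poly_Mapping.keys h \<noteq> {}" using \<open>h \<noteq> 0\<close> by simp
  show ?case
  proof (cases "N = {}")
    case True
    from ne obtain b where "b \<in> Poly_Mapping.keys h" by blast
    with True show ?thesis
      by (intro exI[of _ "Poly_Mapping.lookup h b"]) (auto simp: N_def in_keys_iff)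
  next
    case False
    from ex_unique_sum[OF assms(1,2) fin finite_keys False ne]
    obtain a b where ab: "a \<in> N" "b \<in> Poly_Mapping.keys h"
      and uniq: "\<forall>a'\<in>N. \<forall>b'\<in>Poly_Mapping.keys h. a' + b' = a + b \<longrightarrow> a' = a \<and> b' = b"
      by blast
    let ?s = "Poly_Mapping.lookup f a"
    let ?h = "monoid_scale scale (Poly_Mapping.single 0 ?s) h"
    have "scale ?s (Poly_Mapping.lookup h b) = Poly_Mapping.lookup (monoid_scale scale f h) (a + b)"
      using uniq by (intro lookup_monoid_scale_unique_sum[OF fin sub ab, symmetric])
        (auto simp: N_def)
    then have "scale ?s (Poly_Mapping.lookup h b) = 0"
      by (simp add: less.prems)
    \<comment> \<open>A constant factor creates no new exponents, and \<open>b\<close> drops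
      out.\<close>
    with ab(2) have "Poly_Mapping.keys ?h \<subset> Poly_Mapping.keys h"
      by (auto simp: in_keys_iff lookup_monoid_scale_single_0 scale_zero_right)
    then have "card (Poly_Mapping.keys ?h) < card (Poly_Mapping.keys h)"
      by (intro psubset_card_mono) auto
    \<comment> \<open>As \<open>S[G]\<close> is commutative, the constant can be pulled in front of
      the product of \<open>f\<close> and \<open>h\<close>.\<close>
    moreover have "monoid_scale scale f ?h = 0"
      by (metis less.prems(1) monoid_scale_mult monoid_scale_zero_right mult.commute)
    moreover have "?h \<noteq> 0"
    proof
      assume "?h = 0"
      then have "scale ?s (Poly_Mapping.lookup h b) = 0" for b
        by (simp flip: lookup_monoid_scale_single_0)
      with ab(1) show False by (simp add: N_def)
    qed
    ultimately show ?thesis by (rule less.hyps)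
  qed
qed

text \<open>One direction is McCoy's theorem; for the other, the common annihilator \<open>m\<close>
  is placed at exponent 0.\<close>

lemma zero_divisors_monoid_scale_iff:
  fixes f :: "'g::comm_monoid_add \<Rightarrow>\<^sub>0 's"
  assumes "\<forall>a b c :: 'g. a + b = a + c \<longrightarrow> b = c"
    and "torsion_free_monoid TYPE('g)"
  shows "f \<in> zero_divisors (monoid_scale scale) \<longleftrightarrow>
    (\<exists>m. m \<noteq> 0 \<and> (\<forall>a. scale (Poly_Mapping.lookup f a) m = 0))" (is "?L \<longleftrightarrow> ?R")
proof
  show ?L if ?R
  proof -
    from that obtain m where m: "m \<noteq> 0" "\<And>a. scale (Poly_Mapping.lookup f a) m = 0" by blast
    then have "monoid_scale scale f (Poly_Mapping.single 0 m) = 0"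
      by (simp add: monoid_scale_def)
    moreover have "Poly_Mapping.single (0::'g) m \<noteq> 0"
      using m(1) by (simp add: single_eq_zero_iff)
    ultimately show ?L unfolding zero_divisors_def by blast
  qed
  show ?R if ?L
    using that McCoy[OF assms] unfolding zero_divisors_def by blast
qed

lemma zero_divisors_single:
  assumes "s \<in> zero_divisors scale"
  shows "Poly_Mapping.single g s \<in> zero_divisors (monoid_scale scale)"
proof -
  from assms obtain m where "m \<noteq> 0" "scale s m = 0" unfolding zero_divisors_def by blast
  then have "monoid_scale scale (Poly_Mapping.single g s) (Poly_Mapping.single 0 m) = 0"
    and "Poly_Mapping.single 0 m \<noteq> 0"
    by (simp_all add: monoid_scale_single single_eq_zero_iff)
  then show ?thesis unfolding zero_divisors_def by blast
qed

lemma ann_ideal_generated: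
  assumes "\<And>s. s \<in> A \<Longrightarrow> scale s m = 0" "s \<in> ideal_generated A"
  shows "scale s m = 0"
  using ideal_generated_subset[OF semiring_ideal_annihilator[of m], of A] assms by blast

end

section \<open>Distinct multiples and the equivalence\<close>

text \<open>Equal multiples for \<open>m < n\<close> cancel to \<open>n - m\<close> times
  \<open>g\<close> being 0, which is also \<open>n - m\<close> times 0; torsion-freeness then gives
  \<open>g = 0\<close>.\<close>

lemma inj_nat_multiple:
  assumes cancel: "\<forall>a b c :: 'g::comm_monoid_add. a + b = a + c \<longrightarrow> b = c"
    and tf: "torsion_free_monoid TYPE('g)" and "(g::'g) \<noteq> 0"
  shows "inj (\<lambda>n. nat_multiple n g)"
proof (rule linorder_injI)
  fix m n :: nat assume "m < n"
  show "nat_multiple m g \<noteq> nat_multiple n g"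
  proof
    assume "nat_multiple m g = nat_multiple n g"
    also have "\<dots> = nat_multiple (m + (n - m)) g"
      using \<open>m < n\<close> by simp
    finally have "nat_multiple m g + 0 = nat_multiple m g + nat_multiple (n - m) g"
      by (simp only: nat_multiple_add_left add_0_right)
    then have "nat_multiple (n - m) 0 = nat_multiple (n - m) g"
      using cancel nat_multiple_zero_right by metis
    moreover have "n - m \<ge> 1" using \<open>m < n\<close> by simp
    ultimately show False using torsion_free_monoidD[OF tf] \<open>g \<noteq> 0\<close> by blast
  qed
qed

theorem corollary2p23:
  fixes scale :: "'s::comm_semiring_1 \<Rightarrow> 'm::comm_monoid_add \<Rightarrow> 'm"
  assumes "weak_gaussian TYPE('s)"
    and "semimodule scale"
    and "\<exists>m::'m. m \<noteq> 0"
    and "\<And>a b c :: 'g::comm_monoid_add. a + b = a + c \<Longrightarrow> b = c"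
    and "torsion_free_monoid TYPE('g)"
    and "\<exists>g::'g. g \<noteq> 0"
  shows "primal (monoid_scale scale :: ('g \<Rightarrow>\<^sub>0 's) \<Rightarrow> ('g \<Rightarrow>\<^sub>0 'm) \<Rightarrow> ('g \<Rightarrow>\<^sub>0 'm)) \<longleftrightarrow>
    primal scale \<and> property_A scale"
proof -
  interpret semimodule scale by fact
  let ?scale = "monoid_scale scale :: ('g \<Rightarrow>\<^sub>0 's) \<Rightarrow> ('g \<Rightarrow>\<^sub>0 'm) \<Rightarrow> ('g \<Rightarrow>\<^sub>0 'm)"
  interpret MG: semimodule ?scale by (rule semimodule_monoid_scale)
  have cancel: "\<forall>a b c :: 'g. a + b = a + c \<longrightarrow> b = c"
    using assms(4) by blast
  have nonzero: "\<exists>h :: 'g \<Rightarrow>\<^sub>0 'm. h \<noteq> 0"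
  proof -
    from assms(3) obtain m :: 'm where "m \<noteq> 0" by blast
    then have "Poly_Mapping.single (0::'g) m \<noteq> 0" by (simp add: single_eq_zero_iff)
    then show ?thesis by blast
  qed
  note zd = zero_divisors_monoid_scale_iff[OF cancel assms(5)]
  show ?thesis
  proof (intro iffI conjI)
    assume prim: "primal ?scale"
    then have ideal: "semiring_ideal (zero_divisors ?scale)"
      by (simp add: primal_def)
    show "primal scale"
      unfolding primal_iff[OF assms(3)]
    proof (intro ballI)
      \<comment> \<open>The semiring embeds as constants: the sum is formed in the ideal of zero
        divisors of \<open>M[G]\<close>, and \<open>zd\<close> brings it back to
        \<open>M\<close>.\<close>
      fix s t assume "s \<in> zero_divisors scale" "t \<in> zero_divisors scale"
      then have "Poly_Mapping.single (0::'g) (s + t) \<in> zero_divisors ?scale"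
        using ideal unfolding single_add semiring_ideal_def
        by (blast intro: zero_divisors_single)
      then obtain m where "m \<noteq> 0"
        "\<forall>a. scale (Poly_Mapping.lookup (Poly_Mapping.single (0::'g) (s + t)) a) m = 0"
        unfolding zd by blast
      then have "scale (s + t) m = 0"
        by (metis lookup_single_eq)
      with \<open>m \<noteq> 0\<close> show "s + t \<in> zero_divisors scale"
        unfolding zero_divisors_def by blast
    qed
    show "property_A scale"
      unfolding property_A_def finitely_generated_ideal_def
    proof (intro allI impI, elim conjE exE)
      fix I A :: "'s set"
      assume "I \<subseteq> zero_divisors scale" "finite A" and I: "I = ideal_generated A"
      then have A: "A \<subseteq> zero_divisors scale" using subset_ideal_generated by blast
      \<comment> \<open>This is where \<open>G\<close> being nontrivial enters: the multiples of
        \<open>g\<close> supply a separate exponent for each generator, numbered by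
        \<open>e\<close>.\<close>
      obtain g :: 'g where "g \<noteq> 0" using assms(6) by blast
      from finite_imp_inj_to_nat_seg[OF \<open>finite A\<close>]
      obtain e :: "'s \<Rightarrow> nat" where "inj_on e A" by blast
      define p where "p s = nat_multiple (e s) g" for s
      have p: "inj_on p A"
        using \<open>inj_on e A\<close> inj_nat_multiple[OF cancel assms(5) \<open>g \<noteq> 0\<close>]
        unfolding p_def inj_on_def by blast
      define f where "f = (\<Sum>s\<in>A. Poly_Mapping.single (p s) s)"
      \<comment> \<open>Each monomial is a zero divisor of \<open>M[G]\<close>, and primality of
        \<open>M[G]\<close> carries this over to finite sums.\<close>
      have "(\<Sum>s\<in>B. Poly_Mapping.single (p s) s) \<in> zero_divisors ?scale" if "B \<subseteq> A" for B
        using finite_subset[OF that \<open>finite A\<close>] that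
      proof (induction B rule: finite_induct)
        case empty
        then show ?case using zero_in_semiring_ideal[OF ideal] by simp
      next
        case (insert s B)
        then show ?case
          using A ideal zero_divisors_single[of s "p s"] by (auto simp: semiring_ideal_def)
      qed
      then have "f \<in> zero_divisors ?scale" by (simp add: f_def)
      then obtain m where m: "m \<noteq> 0" "\<And>a. scale (Poly_Mapping.lookup f a) m = 0"
        unfolding zd by blast
      \<comment> \<open>Since \<open>p\<close> is injective on \<open>A\<close>, no two generators
        merge into one coefficient, so \<open>m\<close> annihilates each of them.\<close>
      have "Poly_Mapping.lookup f (p s) = s" if "s \<in> A" for s
      proof -
        have "Poly_Mapping.lookup f (p s) = (\<Sum>t\<in>A. if t = s then t else 0)"
          unfolding f_def lookup_sum lookup_single
          by (intro sum.cong refl) (use p that in \<open>auto simp: when_def inj_on_def\<close>)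
        with \<open>finite A\<close> that show ?thesis by simp
      qed
      with m(2) have "scale s m = 0" if "s \<in> A" for s
        using that by metis
      with m(1) show "\<exists>m. m \<noteq> 0 \<and> (\<forall>s\<in>I. scale s m = 0)"
        unfolding I using ann_ideal_generated by blast
    qed
  next
    assume prim: "primal scale \<and> property_A scale"
    then have ideal: "semiring_ideal (zero_divisors scale)"
      by (simp add: primal_def)
    show "primal ?scale"
      unfolding MG.primal_iff[OF nonzero]
    proof (intro ballI)
      fix f f' assume "f \<in> zero_divisors ?scale" "f' \<in> zero_divisors ?scale"
      then have "Poly_Mapping.lookup f a \<in> zero_divisors scale"
        "Poly_Mapping.lookup f' a \<in> zero_divisors scale" for a
        unfolding zd zero_divisors_def[of scale] by blast+
      with ideal have coeff: "Poly_Mapping.lookup (f + f') a \<in> zero_divisors scale" for a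
        by (simp add: lookup_add semiring_ideal_def)
      \<comment> \<open>Primality of \<open>M\<close> has made each coefficient of
        \<open>f + f'\<close> a zero divisor separately; Property (A) for the ideal they generate
        yields one annihilator for all.\<close>
      let ?I = "ideal_generated (Poly_Mapping.lookup (f + f') ` Poly_Mapping.keys (f + f'))"
      have "finitely_generated_ideal ?I"
        unfolding finitely_generated_ideal_def by (metis finite_imageI finite_keys)
      moreover have "?I \<subseteq> zero_divisors scale"
        using coeff by (intro ideal_generated_subset[OF ideal]) blast
      ultimately obtain m where m: "m \<noteq> 0" "\<forall>s\<in>?I. scale s m = 0"
        using prim unfolding property_A_def by blast
      have "scale (Poly_Mapping.lookup (f + f') a) m = 0" for a
      proof (cases "a \<in> Poly_Mapping.keys (f + f')")
        case True
        then show ?thesis using m(2) subset_ideal_generated by blast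
      qed (simp add: in_keys_iff scale_zero_left)
      with m(1) show "f + f' \<in> zero_divisors ?scale"
        unfolding zd by blast
    qed
  qed
qed

end
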